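(* Let $I,J\subset\mathbb{R}$ be intervals, $f:I\times J\to I$, $f_\lambda(x)=f(x,\lambda)$, $\lambda_0\in J$, $f_0=f_{\lambda_0}$. Assume: (H1) $f$ is a $C^1$ family of $C^2$ interval maps; (H2) $f_0$ is not constant on any interval; (H3) $f_0$ has at most one of: (a) a non-hyperbolic fixed point or periodic orbit, which as $\lambda$ varies is a generic codimension-one period-doubling or saddle-node bifurcation; (b) one critical point which constitutes a tangency between stable and unstable manifolds of fixed points or periodic orbits, generic in that as $\lambda$ varies through $\lambda_0$ the critical point moves from one side of the periodic point to the other; (H4) for each $\lambda$, $x_\lambda$ is a repelling fixed point of $f_\lambda$, $x_0:=x_{\lambda_0}$, and $y$ is a homoclinic point to $x_0$ for $f_0$; (H5) the homoclinic orbit containing $y$ at $\lambda_0$ contains only one critical point of $f_0$; (H6) $w$ is a homoclinic tangency point to $x_0$ for $f_0$ contained in at least one homoclinic orbit $(z_{-k})_{k\ge0}$, with $w=z_{-L}$. If $w\in U_{right}\cap U_{left}$, then $(w,\lambda_0)$ is not a chain explosion point.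
   Context: An $\epsilon$-chain for $g$ from $x$ to $y$: $z_0=x,\dots,z_N=y$ with $|g(z_{n-1})-z_n|<\epsilon$; $x$ is chain recurrent if for every $\epsilon>0$ there is such a chain from $x$ to itself with $N>0$. $(x,\lambda_0)$ is a chain explosion point if $x$ is chain recurrent for $f_{\lambda_0}$ but some neighborhood of $x$ contains no chain recurrent point of $f_\lambda$ for all $\lambda$ on one side of $\lambda_0$. For a repelling fixed point $x_0$, $y$ is homoclinic to $x_0$ if $y$ lies in the unstable manifold of $x_0$ and $f_0^K(y)=x_0$ for some $K>0$. A homoclinic orbit is a sequence $(z_{-k})_{k\ge0}$ with $z_0=x_0$, $z_{-K}=y$ for some $K$, $f_0(z_{-k})=z_{-k+1}$, $z_{-k}\to x_0$; $w=z_{-L}$ is a homoclinic tangency point if the graph of $f_0$ has a horizontal tangent at $w$. The sets $U_{left},U_{right}$ are defined when $f_0'(x_0)>0$: the local left and right branches of the unstable manifold of $x_0$ (small one-sided neighborhoods of $x_0$) are disjoint, and $U_{left}$, $U_{right}$ are the unions of all forward images under $f_0$ of the local left and right branches, respectively. *)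

theory Defs
  imports "HOL-Analysis.Analysis"
begin

definition dw :: "real set \<Rightarrow> (real \<Rightarrow> real) \<Rightarrow> real \<Rightarrow> real" where
  "dw S g x = (SOME d. (g has_real_derivative d) (at x within S))"

definition C2_map :: "real set \<Rightarrow> (real \<Rightarrow> real) \<Rightarrow> bool" where
  "C2_map I g \<longleftrightarrow> (\<exists>g1 g2. continuous_on I g2 \<and>
      (\<forall>x\<in>I. (g has_real_derivative g1 x) (at x within I) \<and>
               (g1 has_real_derivative g2 x) (at x within I)))"

definition C1_family_of_C2_maps :: "real set \<Rightarrow> real set \<Rightarrow> (real \<Rightarrow> real \<Rightarrow> real) \<Rightarrow> bool" where
  "C1_family_of_C2_maps I J f \<longleftrightarrow>
     (\<exists>Dx Dl. continuous_on (I \<times> J) (\<lambda>p. Dx (fst p) (snd p)) \<and>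
              continuous_on (I \<times> J) (\<lambda>p. Dl (fst p) (snd p)) \<and>
              (\<forall>x\<in>I. \<forall>l\<in>J. ((\<lambda>p. f (fst p) (snd p)) has_derivative
                    (\<lambda>h. Dx x l * fst h + Dl x l * snd h)) (at (x, l) within I \<times> J)))
   \<and> (\<forall>l\<in>J. C2_map I (\<lambda>x. f x l))"

definition periodic_pt :: "(real \<Rightarrow> real) \<Rightarrow> nat \<Rightarrow> real \<Rightarrow> bool" where
  "periodic_pt g n p \<longleftrightarrow> 0 < n \<and> (g ^^ n) p = p \<and> (\<forall>m. 0 < m \<and> m < n \<longrightarrow> (g ^^ m) p \<noteq> p)"

definition porbit :: "(real \<Rightarrow> real) \<Rightarrow> nat \<Rightarrow> real \<Rightarrow> real set" where
  "porbit g n p = {(g ^^ j) p | j. j < n}"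

definition unstable_set :: "real set \<Rightarrow> (real \<Rightarrow> real) \<Rightarrow> real set \<Rightarrow> real \<Rightarrow> bool" where
  "unstable_set I g S y \<longleftrightarrow> (\<exists>b. b 0 = y \<and> (\<forall>k. b k \<in> I \<and> g (b (Suc k)) = b k) \<and>
                                  (\<lambda>k. infdist (b k) S) \<longlonglongrightarrow> 0)"

definition repelling_fixed_point :: "real set \<Rightarrow> (real \<Rightarrow> real) \<Rightarrow> real \<Rightarrow> bool" where
  "repelling_fixed_point I g x \<longleftrightarrow> x \<in> I \<and> g x = x \<and> \<bar>dw I g x\<bar> > 1"

definition homoclinic_point :: "real set \<Rightarrow> (real \<Rightarrow> real) \<Rightarrow> real \<Rightarrow> real \<Rightarrow> bool" where
  "homoclinic_point I g x0 y \<longleftrightarrow> y \<in> I \<and> unstable_set I g {x0} y \<and> (\<exists>K>0. (g ^^ K) y = x0)"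

(* z k plays the role of z_{-k} *)
definition homoclinic_orbit :: "real set \<Rightarrow> (real \<Rightarrow> real) \<Rightarrow> real \<Rightarrow> (nat \<Rightarrow> real) \<Rightarrow> bool" where
  "homoclinic_orbit I g x0 z \<longleftrightarrow> z 0 = x0 \<and> (\<exists>K. homoclinic_point I g x0 (z K)) \<and>
       (\<forall>k. z k \<in> I \<and> g (z (Suc k)) = z k) \<and> z \<longlonglongrightarrow> x0"

(* unions of forward images of the local left / right branches of the unstable manifold of x0
   (independent of the size of the small one-sided neighbourhood) *)
definition U_left :: "real set \<Rightarrow> (real \<Rightarrow> real) \<Rightarrow> real \<Rightarrow> real set" where
  "U_left I g x0 = {y. \<forall>\<delta>>0. \<exists>n u. u \<in> I \<and> x0 - \<delta> < u \<and> u < x0 \<and> (g ^^ n) u = y}"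

definition U_right :: "real set \<Rightarrow> (real \<Rightarrow> real) \<Rightarrow> real \<Rightarrow> real set" where
  "U_right I g x0 = {y. \<forall>\<delta>>0. \<exists>n u. u \<in> I \<and> x0 < u \<and> u < x0 + \<delta> \<and> (g ^^ n) u = y}"

definition chain_recurrent :: "real set \<Rightarrow> (real \<Rightarrow> real) \<Rightarrow> real \<Rightarrow> bool" where
  "chain_recurrent I g x \<longleftrightarrow> x \<in> I \<and>
     (\<forall>\<epsilon>>0. \<exists>(N::nat) (z::nat \<Rightarrow> real). 0 < N \<and> z 0 = x \<and> z N = x \<and> (\<forall>n\<le>N. z n \<in> I) \<and>
                 (\<forall>n. 0 < n \<and> n \<le> N \<longrightarrow> \<bar>g (z (n - 1)) - z n\<bar> < \<epsilon>))"

definition chain_explosion_point ::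
  "real set \<Rightarrow> real set \<Rightarrow> (real \<Rightarrow> real \<Rightarrow> real) \<Rightarrow> real \<Rightarrow> real \<Rightarrow> bool" where
  "chain_explosion_point I J f x l0 \<longleftrightarrow> chain_recurrent I (\<lambda>u. f u l0) x \<and>
     (\<exists>r>0. \<exists>\<delta>>0.
        (\<forall>l\<in>J. l0 - \<delta> < l \<and> l < l0 \<longrightarrow> \<not> (\<exists>u\<in>ball x r. chain_recurrent I (\<lambda>v. f v l) u)) \<or>
        (\<forall>l\<in>J. l0 < l \<and> l < l0 + \<delta> \<longrightarrow> \<not> (\<exists>u\<in>ball x r. chain_recurrent I (\<lambda>v. f v l) u)))"

definition nonhyperbolic_periodic :: "real set \<Rightarrow> (real \<Rightarrow> real) \<Rightarrow> nat \<Rightarrow> real \<Rightarrow> bool" where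
  "nonhyperbolic_periodic I g n p \<longleftrightarrow> p \<in> I \<and> periodic_pt g n p \<and> \<bar>dw I (g ^^ n) p\<bar> = 1"

definition generic_saddle_node ::
  "real set \<Rightarrow> real set \<Rightarrow> (real \<Rightarrow> real \<Rightarrow> real) \<Rightarrow> real \<Rightarrow> nat \<Rightarrow> real \<Rightarrow> bool" where
  "generic_saddle_node I J f l0 n p \<longleftrightarrow>
     dw I ((\<lambda>x. f x l0) ^^ n) p = 1 \<and>
     dw I (dw I ((\<lambda>x. f x l0) ^^ n)) p \<noteq> 0 \<and>
     dw J (\<lambda>l. ((\<lambda>x. f x l) ^^ n) p) l0 \<noteq> 0"

definition generic_period_doubling ::
  "real set \<Rightarrow> real set \<Rightarrow> (real \<Rightarrow> real \<Rightarrow> real) \<Rightarrow> real \<Rightarrow> nat \<Rightarrow> real \<Rightarrow> bool" where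
  "generic_period_doubling I J f l0 n p \<longleftrightarrow>
     dw I ((\<lambda>x. f x l0) ^^ n) p = -1 \<and>
     (\<exists>pc \<delta> d. \<delta> > 0 \<and> pc l0 = p \<and> d \<noteq> 0 \<and>
        continuous_on (J \<inter> ball l0 \<delta>) pc \<and>
        (\<forall>l\<in>J \<inter> ball l0 \<delta>. pc l \<in> I \<and> ((\<lambda>x. f x l) ^^ n) (pc l) = pc l) \<and>
        ((\<lambda>l. dw I ((\<lambda>x. f x l) ^^ n) (pc l)) has_real_derivative d) (at l0 within J)) \<and>
     (\<exists>s\<in>{-1, 1::real}.
        (\<forall>e>0. \<exists>\<delta>>0. \<forall>l\<in>J. 0 < s * (l - l0) \<and> s * (l - l0) < \<delta> \<longrightarrow>
            (\<exists>q\<in>I. periodic_pt (\<lambda>x. f x l) (2 * n) q \<and> \<bar>q - p\<bar> < e)) \<and>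
        (\<exists>e>0. \<exists>\<delta>>0. \<forall>l\<in>J. 0 < - s * (l - l0) \<and> - s * (l - l0) < \<delta> \<longrightarrow>
            \<not> (\<exists>q\<in>I. periodic_pt (\<lambda>x. f x l) (2 * n) q \<and> \<bar>q - p\<bar> < e)))"

(* c is a critical point of g lying in the unstable manifold of some periodic orbit and
   mapped by g^K onto the period-n point p (a tangency of stable and unstable manifolds) *)
definition tangency_crit :: "real set \<Rightarrow> (real \<Rightarrow> real) \<Rightarrow> real \<Rightarrow> real \<Rightarrow> nat \<Rightarrow> nat \<Rightarrow> bool" where
  "tangency_crit I g c p n K \<longleftrightarrow> c \<in> I \<and> dw I g c = 0 \<and> periodic_pt g n p \<and> (g ^^ K) c = p \<and>
     (\<exists>q m. periodic_pt g m q \<and> unstable_set I g (porbit g m q) c)"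

definition generic_tangency ::
  "real set \<Rightarrow> real set \<Rightarrow> (real \<Rightarrow> real \<Rightarrow> real) \<Rightarrow> real \<Rightarrow> real \<Rightarrow> real \<Rightarrow> nat \<Rightarrow> nat \<Rightarrow> bool" where
  "generic_tangency I J f l0 c p n K \<longleftrightarrow>
     (\<exists>cc pc \<delta> s. \<delta> > 0 \<and> s \<in> {-1, 1} \<and> cc l0 = c \<and> pc l0 = p \<and>
        continuous_on (J \<inter> ball l0 \<delta>) cc \<and> continuous_on (J \<inter> ball l0 \<delta>) pc \<and>
        (\<forall>l\<in>J \<inter> ball l0 \<delta>. cc l \<in> I \<and> pc l \<in> I \<and> dw I (\<lambda>x. f x l) (cc l) = 0 \<and>
                               ((\<lambda>x. f x l) ^^ n) (pc l) = pc l) \<and>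
        (\<forall>l\<in>J. l0 - \<delta> < l \<and> l < l0 \<longrightarrow> sgn (((\<lambda>x. f x l) ^^ K) (cc l) - pc l) = s) \<and>
        (\<forall>l\<in>J. l0 < l \<and> l < l0 + \<delta> \<longrightarrow> sgn (((\<lambda>x. f x l) ^^ K) (cc l) - pc l) = - s))"

definition H3 :: "real set \<Rightarrow> real set \<Rightarrow> (real \<Rightarrow> real \<Rightarrow> real) \<Rightarrow> real \<Rightarrow> bool" where
  "H3 I J f l0 \<longleftrightarrow>
    (let g = (\<lambda>x. f x l0);
         NH = {p. \<exists>n. nonhyperbolic_periodic I g n p};
         TC = {c. \<exists>p n K. tangency_crit I g c p n K}
     in (NH = {} \<and> TC = {}) \<or>
        (TC = {} \<and> (\<exists>n p. nonhyperbolic_periodic I g n p \<and> NH = porbit g n p \<and>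
                     (generic_saddle_node I J f l0 n p \<or> generic_period_doubling I J f l0 n p))) \<or>
        (NH = {} \<and> (\<exists>c. TC = {c} \<and>
                     (\<exists>p n K. tangency_crit I g c p n K \<and> generic_tangency I J f l0 c p n K))))"

end

theory Submission
  imports Defs
begin

text \<open>
  Let \<open>g = f\<^sub>0\<close> and \<open>g\<^sup>L w = x\<^sub>0\<close>. Since \<open>g\<close> is nowhere constant, \<open>g\<^sup>L\<close> maps every
  short segment from \<open>w\<close> towards \<open>x\<^sub>0\<close> onto a nondegenerate interval at \<open>x\<^sub>0\<close>; as \<open>w\<close> is a
  forward image of both local branches of the unstable manifold of \<open>x\<^sub>0\<close>, some point \<open>q\<close> of
  that segment, arbitrarily close to \<open>w\<close>, satisfies \<open>g\<^sup>m q = w\<close>, while \<open>g\<^sup>m w = x\<^sub>0\<close>.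
  Hence \<open>g\<^sup>m - id\<close> changes sign between \<open>q\<close> and \<open>w\<close>. This sign change survives small
  perturbations of \<open>\<lambda>\<close> on either side of \<open>\<lambda>\<^sub>0\<close>, producing periodic, hence chain recurrent,
  points of \<open>f\<^sub>\<lambda>\<close> near \<open>w\<close>. Only continuity of \<open>f\<close>, (H2), the fixed point \<open>x\<^sub>\<lambda>\<close> and
  the homoclinic orbit through \<open>w\<close> are used.
\<close>

definition nowhere_constant :: "real set \<Rightarrow> (real \<Rightarrow> real) \<Rightarrow> bool" where
  "nowhere_constant I g \<longleftrightarrow> (\<forall>a b. a < b \<and> {a..b} \<subseteq> I \<longrightarrow> \<not> (\<forall>x\<in>{a..b}. g x = g a))"

lemma funpow_in_invariant_set:
  "(\<And>x. x \<in> S \<Longrightarrow> h x \<in> S) \<Longrightarrow> x \<in> S \<Longrightarrow> (h ^^ k) x \<in> S"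
  by (induction k) auto

lemma funpow_fixed_point: "h x = x \<Longrightarrow> (h ^^ k) x = x"
  by (induction k) auto

lemma continuous_on_funpow:
  assumes "continuous_on S h" and "h ` S \<subseteq> S"
  shows "continuous_on S (h ^^ k)"
proof (induction k)
  case (Suc k)
  have "(h ^^ k) ` S \<subseteq> S"
    using funpow_in_invariant_set[of S h] assms(2) by blast
  then show ?case
    using continuous_on_compose2[OF assms(1) Suc] by (simp add: o_def)
qed simp

lemma C1_family_continuous:
  assumes "C1_family_of_C2_maps I J f"
  shows "continuous_on (I \<times> J) (\<lambda>p. f (fst p) (snd p))"
proof -
  obtain Dx Dl where "\<forall>x\<in>I. \<forall>l\<in>J. ((\<lambda>p. f (fst p) (snd p)) has_derivative
                    (\<lambda>h. Dx x l * fst h + Dl x l * snd h)) (at (x, l) within I \<times> J)"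
    using assms unfolding C1_family_of_C2_maps_def by blast
  then show ?thesis
    unfolding continuous_on_eq_continuous_within by (auto dest: has_derivative_continuous)
qed

lemma continuous_on_section:
  assumes "continuous_on (I \<times> J) (\<lambda>p. f (fst p) (snd p))" and "l \<in> J"
  shows "continuous_on I (\<lambda>x. f x l)"
proof -
  have "continuous_on I (\<lambda>x. f (fst (x, l)) (snd (x, l)))"
    using assms(2) by (intro continuous_on_compose2[OF assms(1)] continuous_intros) auto
  then show ?thesis by simp
qed

lemma continuous_on_funpow_parameter:
  assumes cont: "continuous_on (I \<times> J) (\<lambda>p. f (fst p) (snd p))"
    and maps: "\<forall>x\<in>I. \<forall>l\<in>J. f x l \<in> I" and "p \<in> I"
  shows "continuous_on J (\<lambda>l. ((\<lambda>x. f x l) ^^ k) p)"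
proof (induction k)
  case (Suc k)
  have "(\<lambda>l. (((\<lambda>x. f x l) ^^ k) p, l)) ` J \<subseteq> I \<times> J"
    using funpow_in_invariant_set[of I] maps \<open>p \<in> I\<close> by auto
  then have "continuous_on J (\<lambda>l. f (fst (((\<lambda>x. f x l) ^^ k) p, l)) (snd (((\<lambda>x. f x l) ^^ k) p, l)))"
    by (intro continuous_on_compose2[OF cont] continuous_intros Suc)
  then show ?case by simp
qed simp

lemma nowhere_constant_funpow:
  assumes cont: "continuous_on I g" and maps: "g ` I \<subseteq> I" and nc: "nowhere_constant I g"
  shows "nowhere_constant I (g ^^ k)"
  unfolding nowhere_constant_def
proof (intro allI impI)
  fix a b :: real assume ab: "a < b \<and> {a..b} \<subseteq> I"
  have "\<exists>s\<in>{a..b}. \<exists>t\<in>{a..b}. (g ^^ k) s \<noteq> (g ^^ k) t"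
  proof (induction k)
    case 0
    show ?case using ab by (intro bexI[of _ a] bexI[of _ b]) auto
  next
    case (Suc k)
    then obtain s t where st: "s \<in> {a..b}" "t \<in> {a..b}" "(g ^^ k) s \<noteq> (g ^^ k) t"
      by blast
    define T where "T = (g ^^ k) ` {a..b}"
    have "connected T" unfolding T_def
      using continuous_on_subset[OF continuous_on_funpow[OF cont maps]] ab
      by (intro connected_continuous_image) auto
    define c d where "c = min ((g ^^ k) s) ((g ^^ k) t)" and "d = max ((g ^^ k) s) ((g ^^ k) t)"
    have "c < d" "c \<in> T" "d \<in> T"
      using st unfolding c_def d_def T_def by (auto simp: min_def max_def)
    then have cdT: "{c..d} \<subseteq> T"
      using connected_contains_Icc[OF \<open>connected T\<close>] by blast
    moreover have "T \<subseteq> I"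
      unfolding T_def using funpow_in_invariant_set[of I g] maps ab by (auto simp: image_subset_iff)
    ultimately obtain x where x: "x \<in> {c..d}" "g x \<noteq> g c"
      using nc \<open>c < d\<close> unfolding nowhere_constant_def by blast
    obtain s' t' where "s' \<in> {a..b}" "x = (g ^^ k) s'" "t' \<in> {a..b}" "c = (g ^^ k) t'"
      using x(1) cdT \<open>c \<in> T\<close> unfolding T_def by blast
    moreover from this x(2) have "(g ^^ Suc k) s' \<noteq> (g ^^ Suc k) t'"
      by simp
    ultimately show ?case by blast
  qed
  then show "\<not> (\<forall>x\<in>{a..b}. (g ^^ k) x = (g ^^ k) a)"
    by metis
qed

lemma nowhere_constant_on_segment:
  assumes "nowhere_constant I g" and "a \<noteq> b" and "closed_segment a b \<subseteq> I"
  shows "\<exists>x\<in>closed_segment a b. g x \<noteq> g a"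
proof -
  have "closed_segment a b = {min a b..max a b}" "min a b < max a b"
    using \<open>a \<noteq> b\<close> by (auto simp: closed_segment_eq_real_ivl min_def max_def)
  then obtain x where "x \<in> closed_segment a b" "g x \<noteq> g (min a b)"
    using assms(1,3) unfolding nowhere_constant_def by metis
  moreover have "min a b \<in> closed_segment a b"
    by (simp add: min_def)
  ultimately show ?thesis
    by metis
qed

lemma periodic_point_chain_recurrent:
  assumes maps: "\<forall>x\<in>I. h x \<in> I" and "u \<in> I" and "(h ^^ m) u = u" and "0 < m"
  shows "chain_recurrent I h u"
  unfolding chain_recurrent_def
proof (intro conjI allI impI)
  fix e :: real assume "e > 0"
  show "\<exists>(N::nat) (z::nat \<Rightarrow> real). 0 < N \<and> z 0 = u \<and> z N = u \<and> (\<forall>n\<le>N. z n \<in> I) \<and>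
          (\<forall>n. 0 < n \<and> n \<le> N \<longrightarrow> \<bar>h (z (n - 1)) - z n\<bar> < e)"
  proof (intro exI[of _ m] exI[of _ "\<lambda>n. (h ^^ n) u"] conjI allI impI)
    fix n assume "0 < n \<and> n \<le> m"
    then show "\<bar>h ((h ^^ (n - 1)) u) - (h ^^ n) u\<bar> < e"
      using \<open>e > 0\<close> by (cases n) auto
  qed (use assms funpow_in_invariant_set[of I h] in auto)
qed (fact \<open>u \<in> I\<close>)

lemma zero_in_segment_of_sign_change:
  fixes \<phi> :: "real \<Rightarrow> real"
  assumes "continuous_on (closed_segment a b) \<phi>" and "\<phi> a * \<phi> b < 0"
  shows "\<exists>u\<in>closed_segment a b. \<phi> u = 0"
proof -
  have "0 \<in> closed_segment (\<phi> a) (\<phi> b)"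
    using assms(2) unfolding closed_segment_eq_real_ivl
    by (auto simp: mult_less_0_iff)
  then show ?thesis
    using IVT'_closed_segment_real assms(1) by blast
qed

lemma homoclinic_orbit_funpow:
  assumes "homoclinic_orbit I g x0 z"
  shows "z k \<in> I" and "(g ^^ k) (z k) = x0"
proof -
  have z: "z 0 = x0" "\<And>k. z k \<in> I \<and> g (z (Suc k)) = z k"
    using assms unfolding homoclinic_orbit_def by auto
  then show "z k \<in> I" by blast
  show "(g ^^ k) (z k) = x0"
    by (induction k) (simp_all add: z funpow_Suc_right del: funpow.simps(2))
qed

lemma U_left_U_right_preimage_in_connected:
  assumes "connected T" and "x0 \<in> T" and "v \<in> T" and "v \<noteq> x0"
    and "w \<in> U_right I g x0 \<inter> U_left I g x0"
  obtains u n where "u \<in> T" and "u \<noteq> x0" and "(g ^^ n) u = w"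
proof (cases "x0 < v")
  case True
  then obtain n u where "x0 < u" "u < v" "(g ^^ n) u = w"
    using assms(5) unfolding U_right_def by (force dest: spec[of _ "v - x0"])
  moreover have "{x0..v} \<subseteq> T"
    using connected_contains_Icc assms(1-3) by blast
  ultimately have "u \<in> T" "u \<noteq> x0" "(g ^^ n) u = w"
    by auto
  then show ?thesis by (rule that)
next
  case False
  then obtain n u where "v < u" "u < x0" "(g ^^ n) u = w"
    using assms(4,5) unfolding U_left_def by (force dest: spec[of _ "x0 - v"])
  moreover have "{v..x0} \<subseteq> T"
    using connected_contains_Icc assms(1-3) by blast
  ultimately have "u \<in> T" "u \<noteq> x0" "(g ^^ n) u = w"
    by auto
  then show ?thesis by (rule that)
qed

lemma segment_toward_within_ball:
  fixes w x0 r :: real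
  assumes "w \<noteq> x0" and "r > 0"
  obtains p where "p \<noteq> w" and "p \<in> closed_segment w x0" and "dist p w < r"
proof
  let ?p = "if w < x0 then min x0 (w + r/2) else max x0 (w - r/2)"
  show "?p \<noteq> w" "?p \<in> closed_segment w x0" "dist ?p w < r"
    using assms by (auto simp: closed_segment_eq_real_ivl dist_real_def)
qed

lemma segment_same_side:
  fixes q w x0 :: real
  assumes "q \<in> closed_segment w x0" and "q \<noteq> w"
  shows "0 < (q - w) * (x0 - w)"
  using assms by (auto simp: closed_segment_eq_real_ivl zero_less_mult_iff split: if_splits)

lemma returning_points_near_homoclinic_point:
  fixes g :: "real \<Rightarrow> real"
  assumes "is_interval I" and cont: "continuous_on I g" and maps: "g ` I \<subseteq> I"
    and nc: "nowhere_constant I g" and "x0 \<in> I" and "g x0 = x0"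
    and "w \<in> I" and "w \<noteq> x0" and wL: "(g ^^ L) w = x0"
    and wU: "w \<in> U_right I g x0 \<inter> U_left I g x0" and "r > 0"
  obtains q m where "closed_segment q w \<subseteq> I \<inter> ball w r" and "0 < (q - w) * (x0 - w)"
    and "0 < m" and "(g ^^ m) q = w" and "(g ^^ m) w = x0"
proof -
  obtain p where p: "p \<noteq> w" "p \<in> closed_segment w x0" "dist p w < r"
    using segment_toward_within_ball \<open>w \<noteq> x0\<close> \<open>r > 0\<close> by blast
  define S where "S = closed_segment w p"
  have S_sub: "S \<subseteq> closed_segment w x0"
    unfolding S_def using p(2) by (simp add: closed_segment_subset convex_closed_segment)
  also have "closed_segment w x0 \<subseteq> I"
    using \<open>is_interval I\<close> \<open>w \<in> I\<close> \<open>x0 \<in> I\<close> by (simp add: closed_segment_subset is_interval_convex)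
  finally have "S \<subseteq> I" .
  have "S \<subseteq> ball w r"
    using p(3) dist_in_closed_segment[of _ w p] unfolding S_def by (force simp: dist_commute)
  obtain v where "v \<in> S" "(g ^^ L) v \<noteq> x0"
    using nowhere_constant_on_segment[OF nowhere_constant_funpow[OF cont maps nc]] p(1) \<open>S \<subseteq> I\<close> wL
    unfolding S_def by metis
  moreover have "connected ((g ^^ L) ` S)"
    using continuous_on_subset[OF continuous_on_funpow[OF cont maps] \<open>S \<subseteq> I\<close>]
    by (intro connected_continuous_image) (simp_all add: S_def)
  moreover have "x0 \<in> (g ^^ L) ` S"
    using wL unfolding S_def by force
  ultimately obtain u n where "u \<in> (g ^^ L) ` S" "u \<noteq> x0" "(g ^^ n) u = w"
    using U_left_U_right_preimage_in_connected wU by (metis imageI)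
  then obtain q where q: "q \<in> S" "(g ^^ L) q = u"
    by blast
  show ?thesis
  proof
    have "closed_segment q w \<subseteq> S"
      using q(1) unfolding S_def by (simp add: closed_segment_subset convex_closed_segment)
    then show "closed_segment q w \<subseteq> I \<inter> ball w r"
      using \<open>S \<subseteq> I\<close> \<open>S \<subseteq> ball w r\<close> by blast
    show "0 < (q - w) * (x0 - w)"
      using segment_same_side q S_sub \<open>u \<noteq> x0\<close> wL by blast
    show "0 < n + L" using wL \<open>w \<noteq> x0\<close> by (cases L) auto
    show "(g ^^ (n + L)) q = w" using q(2) \<open>(g ^^ n) u = w\<close> by (simp add: funpow_add)
    show "(g ^^ (n + L)) w = x0" using wL funpow_fixed_point \<open>g x0 = x0\<close> by (simp add: funpow_add)
  qed
qed

lemma fixed_point_of_iterate_persists: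
  fixes f :: "real \<Rightarrow> real \<Rightarrow> real"
  assumes cont: "continuous_on (I \<times> J) (\<lambda>p. f (fst p) (snd p))"
    and maps: "\<forall>x\<in>I. \<forall>l\<in>J. f x l \<in> I" and "closed_segment q w \<subseteq> I" and "l0 \<in> J"
    and sign: "(((\<lambda>x. f x l0) ^^ m) q - q) * (((\<lambda>x. f x l0) ^^ m) w - w) < 0"
  obtains \<eta> where "\<eta> > 0"
    and "\<And>l. l \<in> J \<Longrightarrow> dist l l0 < \<eta> \<Longrightarrow> \<exists>u\<in>closed_segment q w. ((\<lambda>x. f x l) ^^ m) u = u"
proof -
  define P where "P l = (((\<lambda>x. f x l) ^^ m) q - q) * (((\<lambda>x. f x l) ^^ m) w - w)" for l
  have "q \<in> I" "w \<in> I"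
    using \<open>closed_segment q w \<subseteq> I\<close> by auto
  then have "continuous_on J P"
    unfolding P_def by (intro continuous_intros continuous_on_funpow_parameter[OF cont maps] \<open>q \<in> I\<close> \<open>w \<in> I\<close>)
  then have "(P \<longlongrightarrow> P l0) (at l0 within J)"
    using \<open>l0 \<in> J\<close> continuous_on_def by blast
  then have "\<forall>\<^sub>F l in at l0 within J. P l < 0"
    using sign unfolding P_def by (auto dest: order_tendstoD(2))
  then obtain \<eta> where "\<eta> > 0" and \<eta>: "\<And>l. l \<in> J \<Longrightarrow> l \<noteq> l0 \<Longrightarrow> dist l l0 < \<eta> \<Longrightarrow> P l < 0"
    unfolding eventually_at by blast
  show ?thesis
  proof (rule that[OF \<open>\<eta> > 0\<close>])
    fix l assume l: "l \<in> J" "dist l l0 < \<eta>"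
    define h where "h = (\<lambda>x. f x l)"
    have "P l < 0"
      using \<eta> l sign unfolding P_def by (cases "l = l0") auto
    moreover have "continuous_on (closed_segment q w) (\<lambda>x. (h ^^ m) x - x)"
      using continuous_on_funpow[OF continuous_on_section[OF cont l(1)], of m] maps l(1)
        \<open>closed_segment q w \<subseteq> I\<close>
      unfolding h_def by (auto intro!: continuous_intros intro: continuous_on_subset)
    ultimately show "\<exists>u\<in>closed_segment q w. (h ^^ m) u = u"
      using zero_in_segment_of_sign_change[of q w "\<lambda>x. (h ^^ m) x - x"]
      unfolding P_def h_def by auto
  qed
qed

lemma chain_explosion_point_nearby_parameter:
  fixes l0 :: real
  assumes "chain_explosion_point I J f x l0" and "l0 \<in> interior J"
  obtains r where "r > 0"
    and "\<And>\<eta>. \<eta> > 0 \<Longrightarrow> \<exists>l\<in>J. dist l l0 < \<eta> \<and> (\<forall>u\<in>ball x r. \<not> chain_recurrent I (\<lambda>v. f v l) u)"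
proof -
  obtain r \<delta> where "r > 0" "\<delta> > 0" and no_cr:
    "(\<forall>l\<in>J. l0 - \<delta> < l \<and> l < l0 \<longrightarrow> \<not> (\<exists>u\<in>ball x r. chain_recurrent I (\<lambda>v. f v l) u)) \<or>
     (\<forall>l\<in>J. l0 < l \<and> l < l0 + \<delta> \<longrightarrow> \<not> (\<exists>u\<in>ball x r. chain_recurrent I (\<lambda>v. f v l) u))"
    using assms(1) unfolding chain_explosion_point_def by blast
  obtain d where "d > 0" "ball l0 d \<subseteq> J"
    using assms(2) mem_interior by blast
  show ?thesis
  proof (rule that[OF \<open>r > 0\<close>])
    fix \<eta> :: real assume "\<eta> > 0"
    define t where "t = min d (min \<delta> \<eta>) / 2"
    have t: "t > 0" "t < \<delta>" "t < \<eta>" "l0 - t \<in> J" "l0 + t \<in> J"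
      using \<open>d > 0\<close> \<open>\<delta> > 0\<close> \<open>\<eta> > 0\<close> \<open>ball l0 d \<subseteq> J\<close>
      unfolding t_def by (auto simp: dist_real_def subset_iff)
    from no_cr show "\<exists>l\<in>J. dist l l0 < \<eta> \<and> (\<forall>u\<in>ball x r. \<not> chain_recurrent I (\<lambda>v. f v l) u)"
    proof
      assume "\<forall>l\<in>J. l0 - \<delta> < l \<and> l < l0 \<longrightarrow> \<not> (\<exists>u\<in>ball x r. chain_recurrent I (\<lambda>v. f v l) u)"
      with t show ?thesis
        by (intro bexI[of _ "l0 - t"]) (auto simp: dist_real_def)
    next
      assume "\<forall>l\<in>J. l0 < l \<and> l < l0 + \<delta> \<longrightarrow> \<not> (\<exists>u\<in>ball x r. chain_recurrent I (\<lambda>v. f v l) u)"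
      with t show ?thesis
        by (intro bexI[of _ "l0 + t"]) (auto simp: dist_real_def)
    qed
  qed
qed

theorem mainTheorem5:
  fixes I J :: "real set" and f :: "real \<Rightarrow> real \<Rightarrow> real"
    and l0 y w :: real and xl :: "real \<Rightarrow> real"
  assumes intI: "is_interval I" and ndI: "interior I \<noteq> {}"
    and intJ: "is_interval J" and l0J: "l0 \<in> interior J"
    and maps: "\<forall>x\<in>I. \<forall>l\<in>J. f x l \<in> I"
    and H1: "C1_family_of_C2_maps I J f"
    and H2: "\<forall>a b. a < b \<and> {a..b} \<subseteq> I \<longrightarrow> \<not> (\<forall>x\<in>{a..b}. f x l0 = f a l0)"
    and H3: "H3 I J f l0"
    and H4a: "\<forall>l\<in>J. repelling_fixed_point I (\<lambda>x. f x l) (xl l)"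
    and H4b: "homoclinic_point I (\<lambda>x. f x l0) (xl l0) y"
    and H5: "\<forall>z. homoclinic_orbit I (\<lambda>x. f x l0) (xl l0) z \<and> (\<exists>K. z K = y) \<longrightarrow>
               card {c \<in> range z. dw I (\<lambda>x. f x l0) c = 0} = 1"
    and H6: "\<exists>z L. homoclinic_orbit I (\<lambda>x. f x l0) (xl l0) z \<and> z L = w \<and> dw I (\<lambda>x. f x l0) w = 0"
    and Udef: "dw I (\<lambda>x. f x l0) (xl l0) > 0"
    and wU: "w \<in> U_right I (\<lambda>x. f x l0) (xl l0) \<inter> U_left I (\<lambda>x. f x l0) (xl l0)"
  shows "\<not> chain_explosion_point I J f w l0"
proof
  assume "chain_explosion_point I J f w l0"
  then obtain r where "r > 0" and no_cr:
    "\<And>\<eta>. \<eta> > 0 \<Longrightarrow> \<exists>l\<in>J. dist l l0 < \<eta> \<and> (\<forall>u\<in>ball w r. \<not> chain_recurrent I (\<lambda>v. f v l) u)"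
    using chain_explosion_point_nearby_parameter l0J by blast
  define g x0 where "g = (\<lambda>x. f x l0)" and "x0 = xl l0"
  have cont: "continuous_on (I \<times> J) (\<lambda>p. f (fst p) (snd p))" and "l0 \<in> J"
    using C1_family_continuous[OF H1] l0J interior_subset by blast+
  have g: "continuous_on I g" "g ` I \<subseteq> I" "nowhere_constant I g"
    using continuous_on_section[OF cont \<open>l0 \<in> J\<close>] maps \<open>l0 \<in> J\<close> H2
    unfolding g_def nowhere_constant_def by auto
  have x0: "x0 \<in> I" "g x0 = x0" "dw I g x0 \<noteq> 0"
    using H4a \<open>l0 \<in> J\<close> unfolding repelling_fixed_point_def g_def x0_def by auto
  obtain z L where "homoclinic_orbit I g x0 z" "z L = w" "dw I g w = 0"
    using H6 unfolding g_def x0_def by blast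
  then have "w \<in> I" "(g ^^ L) w = x0" "w \<noteq> x0"
    using homoclinic_orbit_funpow x0(3) by metis+
  then obtain q m where q: "closed_segment q w \<subseteq> I \<inter> ball w r" "0 < (q - w) * (x0 - w)"
    and m: "0 < m" "(g ^^ m) q = w" "(g ^^ m) w = x0"
    using returning_points_near_homoclinic_point[OF intI g x0(1,2)] wU \<open>r > 0\<close>
    unfolding g_def x0_def by metis
  then have "(((\<lambda>x. f x l0) ^^ m) q - q) * (((\<lambda>x. f x l0) ^^ m) w - w) < 0"
    \<comment> \<open>the factors are \<open>w - q\<close> and \<open>x\<^sub>0 - w\<close>\<close>
    unfolding g_def by (simp add: algebra_simps)
  then obtain \<eta> where "\<eta> > 0" and \<eta>:
    "\<And>l. l \<in> J \<Longrightarrow> dist l l0 < \<eta> \<Longrightarrow> \<exists>u\<in>closed_segment q w. ((\<lambda>x. f x l) ^^ m) u = u"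
    using fixed_point_of_iterate_persists[OF cont maps] q(1) \<open>l0 \<in> J\<close> by blast
  obtain l where l: "l \<in> J" "dist l l0 < \<eta>" "\<forall>u\<in>ball w r. \<not> chain_recurrent I (\<lambda>v. f v l) u"
    using no_cr[OF \<open>\<eta> > 0\<close>] by blast
  then obtain u where u: "u \<in> closed_segment q w" "((\<lambda>x. f x l) ^^ m) u = u"
    using \<eta> by blast
  then have "chain_recurrent I (\<lambda>v. f v l) u"
    using q(1) maps l(1) m(1) by (intro periodic_point_chain_recurrent) auto
  with l(3) u(1) q(1) show False
    by blast
qed

end
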